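(* Let $\phi\in\mathbb{R}^{S\times d_\phi}$ and $\psi\in\mathbb{R}^{S\times d_\psi}$ be fixed, and consider the following temporal-difference losses for approximating the successor measure (overlines denote stop-gradient): $$\mathcal{L}_{\mathrm{fw}}(\phi,T_z,\psi)=\tfrac12\,\mathbb{E}_{z}\Big[\big\|\phi T_z\psi^\top-P^{\pi_z}-\gamma\,\overline{P^{\pi_z}\phi T_z\psi^\top}\big\|_F^2\Big],\qquad T_z\in\mathbb{R}^{d_\phi\times d_\psi},$$ $$\mathcal{L}_{\mathrm{bw}}(\phi,T_z,\psi)=\tfrac12\,\mathbb{E}_{z}\Big[\big\|\psi T_z\phi^\top-(P^{\pi_z})^\top-\gamma\,(P^{\pi_z})^\top\overline{\psi T_z\phi^\top}\big\|_F^2\Big],\qquad T_z\in\mathbb{R}^{d_\psi\times d_\phi}.$$ For each $z\in\mathcal{Z}$ let $T_{z,\mathrm{fw}}^\star$, $T_{z,\mathrm{bw}}^\star$, $T_{\phi,z}^\star$, $T_{\psi,z}^\star$ be the optimal predictors for $\mathcal{L}_{\mathrm{fw}}(\phi,T_z,\psi)$, $\mathcal{L}_{\mathrm{bw}}(\phi,T_z,\psi)$, $\mathcal{L}_{\text{TD-JEPA}}(\phi,T_z,\psi)$ and $\mathcal{L}_{\text{TD-JEPA}}(\psi,T_z,\phi)$, respectively. Assume (A1) $\phi^\top\phi=I$ and $\psi^\top\psi=I$; (A2) the state distribution is uniform; (A3) for all $z\in\mathcal{Z}$, the matrix $P^{\pi_z}$ is symmetric. Then: 1. For all $z\in\mathcal{Z}$,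 $\phi T_{\phi,z}^\star=\phi T_{z,\mathrm{fw}}^\star=\tilde\Pi_{\phi,z}M^{\pi_z}\psi$ and $\psi T_{\psi,z}^\star=\psi T_{z,\mathrm{bw}}^\star=\tilde\Pi_{\psi,z}M^{\pi_z}\phi$, where $\tilde\Pi_{\phi,z}$ (resp. $\tilde\Pi_{\psi,z}$) is an oblique projection onto the column span of $\phi$ (resp. $\psi$), determined by $\phi$ and $z$ only (resp. by $\psi$ and $z$ only). 2. For every collection of predictors $\{T_z\}_z$ with $T_z\in\mathbb{R}^{d_\phi\times d_\psi}$, $\nabla_\phi\mathcal{L}_{\text{TD-JEPA}}(\phi,T_z,\psi)=\nabla_\phi\mathcal{L}_{\mathrm{fw}}(\phi,T_z,\psi)$; and for every collection $\{T_z\}_z$ with $T_z\in\mathbb{R}^{d_\psi\times d_\phi}$, $\nabla_\psi\mathcal{L}_{\text{TD-JEPA}}(\psi,T_z,\phi)=\nabla_\psi\mathcal{L}_{\mathrm{bw}}(\phi,T_z,\psi)$.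
   Context: Setting: a finite Markov decision process with $S$ states, transition probabilities $P(s'\mid s,a)$ and discount factor $\gamma\in[0,1)$; a finite index set $\mathcal{Z}$ with a probability distribution $p$ (expectations $\mathbb{E}_z$ are over $z\sim p$); policies $\pi_z$, $z\in\mathcal{Z}$. $P^{\pi_z}\in\mathbb{R}^{S\times S}$ is the row-stochastic matrix with entries $P^{\pi_z}(s'\mid s)=P(s'\mid s,\pi_z(s))$ in row $s$, column $s'$. $M^{\pi_z}=\sum_{t\ge0}\gamma^t(P^{\pi_z})^{t+1}=(I-\gamma P^{\pi_z})^{-1}P^{\pi_z}$ is the (unnormalized) successor measure matrix. For a matrix $\phi\in\mathbb{R}^{S\times d}$, $\phi(s)\in\mathbb{R}^d$ denotes row $s$ as a column vector; $\|\cdot\|_F$ is the Frobenius norm. For the uniform state distribution (with the overall factor $1/S$ dropped), $$\mathcal{L}_{\text{TD-JEPA}}(\phi,T_z,\psi)=\tfrac12\,\mathbb{E}_z\sum_s\sum_{s^+}P^{\pi_z}(s^+\mid s)\,\big\|T_z^\top\phi(s)-\overline{\psi(s^+)}-\gamma\,\overline{T_z^\top\phi(s^+)}\big\|_2^2,\qquad T_z\in\mathbb{R}^{d_\phi\times d_\psi}.$$ $\mathcal{L}_{\text{TD-JEPA}}(\psi,T_z,\phi)$ is the same loss with the roles of $\phi$ and $\psi$ exchanged, with $T_z\in\mathbb{R}^{d_\psi\times d_\phi}$. The argument $T_z$ stands for the whole collection $\{T_z\}_{z\in\mathcal{Z}}$. Stop-gradient (overline): the overlined quantity has its usual value but is treated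 as a constant when differentiating or minimizing. All gradients are Euclidean (unconstrained) matrix gradients in this sense, evaluated at the given $\phi,\psi$ satisfying (A1). Each loss is an average over $z$ of terms depending only on $T_z$; the optimal predictor for $z$ is the matrix $T_z$ at which the stop-gradient gradient with respect to $T_z$ of the $z$-th term vanishes (i.e. $T_z$ minimizes the $z$-th term with the overlined targets held fixed at the values given by $T_z$ itself). An oblique projection onto a subspace is an idempotent matrix ($\Pi\Pi=\Pi$), not necessarily symmetric, whose range is that subspace. *)

theory Defs
  imports "HOL-Analysis.Analysis" "HOL-Probability.Probability_Mass_Function"
begin

text \<open>
  An \<open>m \<times> n\<close> real matrix is an element of \<open>real^'n^'m\<close>. On this type, \<open>norm\<close> is the Frobenius
  norm and the inner product is the Frobenius inner product, so \<open>GDERIV f X :> G\<close> says that \<open>G\<close>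
  is the Euclidean matrix gradient of \<open>f\<close> at \<open>X\<close>.
\<close>

definition policy_matrix ::
  "('s::finite \<Rightarrow> 'a \<Rightarrow> 's pmf) \<Rightarrow> ('z \<Rightarrow> 's \<Rightarrow> 'a) \<Rightarrow> 'z \<Rightarrow> real^'s^'s" where
  "policy_matrix P pol z = (\<chi> s s'. pmf (P s (pol z s)) s')"

text \<open>The operation \<open>^\<close> on \<open>real^'n^'n\<close> is taken entrywise, hence a separate matrix power.\<close>

primrec matrix_power :: "real^'n^'n \<Rightarrow> nat \<Rightarrow> real^'n^'n" where
  "matrix_power A 0 = mat 1"
| "matrix_power A (Suc n) = A ** matrix_power A n"

definition successor_measure :: "real \<Rightarrow> real^'s^'s \<Rightarrow> real^'s^'s" where
  "successor_measure \<gamma> Pz = (\<Sum>t. \<gamma> ^ t *\<^sub>R matrix_power Pz (Suc t))"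

definition orthonormal_columns :: "real^'d^'s \<Rightarrow> bool" where
  "orthonormal_columns \<phi> \<longleftrightarrow> transpose \<phi> ** \<phi> = mat 1"

definition oblique_projection_onto :: "real^'s^'s \<Rightarrow> (real^'s) set \<Rightarrow> bool" where
  "oblique_projection_onto A V \<longleftrightarrow> A ** A = A \<and> range (\<lambda>v. A *v v) = V"

text \<open>
  Stop-gradients: primed arguments are the values used in the overlined parts of a loss, unprimed
  ones those used elsewhere. The value of a loss is obtained by giving both the same values, and a
  stop-gradient derivative at a point by differentiating in an unprimed argument with the primed
  arguments held at that point. In each of the following, \<open>Pz\<close> is the transition matrix of the
  policy with index \<open>z\<close>, and the expression is the summand for \<open>z\<close> of the loss.
\<close>

definition fw_term ::
  "real \<Rightarrow> real^'s^'s \<Rightarrow> real^'d^'s \<Rightarrow> real^'e^'d \<Rightarrow> real^'e^'s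
    \<Rightarrow> real^'d^'s \<Rightarrow> real^'e^'d \<Rightarrow> real^'e^'s \<Rightarrow> real" where
  "fw_term \<gamma> Pz \<phi> T \<psi> \<phi>' T' \<psi>' =
    1/2 * (norm (\<phi> ** T ** transpose \<psi> - Pz
                 - \<gamma> *\<^sub>R (Pz ** \<phi>' ** T' ** transpose \<psi>')))\<^sup>2"

definition bw_term ::
  "real \<Rightarrow> real^'s^'s \<Rightarrow> real^'d^'s \<Rightarrow> real^'d^'e \<Rightarrow> real^'e^'s
    \<Rightarrow> real^'d^'s \<Rightarrow> real^'d^'e \<Rightarrow> real^'e^'s \<Rightarrow> real" where
  "bw_term \<gamma> Pz \<phi> T \<psi> \<phi>' T' \<psi>' =
    1/2 * (norm (\<psi> ** T ** transpose \<phi> - transpose Pz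
                 - \<gamma> *\<^sub>R (transpose Pz ** (\<psi>' ** T' ** transpose \<phi>'))))\<^sup>2"

text \<open>
  The sum over \<open>s\<close> is the expectation under the uniform state distribution, without the factor
  \<open>1 / CARD('s)\<close>. The target representation occurs only under a stop-gradient, so there is no
  unprimed \<open>\<psi>\<close>.
\<close>

definition td_jepa_term ::
  "real \<Rightarrow> real^'s^'s \<Rightarrow> real^'d^'s \<Rightarrow> real^'e^'d
    \<Rightarrow> real^'d^'s \<Rightarrow> real^'e^'d \<Rightarrow> real^'e^'s \<Rightarrow> real" where
  "td_jepa_term \<gamma> Pz \<phi> T \<phi>' T' \<psi>' =
    1/2 * (\<Sum>s\<in>UNIV. \<Sum>s'\<in>UNIV. Pz $ s $ s' *
      (norm (transpose T *v row s \<phi> - row s' \<psi>'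
             - \<gamma> *\<^sub>R (transpose T' *v row s' \<phi>')))\<^sup>2)"

definition fw_loss ::
  "'z pmf \<Rightarrow> real \<Rightarrow> ('z \<Rightarrow> real^'s^'s) \<Rightarrow> real^'d^'s \<Rightarrow> ('z \<Rightarrow> real^'e^'d) \<Rightarrow> real^'e^'s
    \<Rightarrow> real^'d^'s \<Rightarrow> ('z \<Rightarrow> real^'e^'d) \<Rightarrow> real^'e^'s \<Rightarrow> real" where
  "fw_loss p \<gamma> Pm \<phi> T \<psi> \<phi>' T' \<psi>' =
    measure_pmf.expectation p (\<lambda>z. fw_term \<gamma> (Pm z) \<phi> (T z) \<psi> \<phi>' (T' z) \<psi>')"

definition bw_loss ::
  "'z pmf \<Rightarrow> real \<Rightarrow> ('z \<Rightarrow> real^'s^'s) \<Rightarrow> real^'d^'s \<Rightarrow> ('z \<Rightarrow> real^'d^'e) \<Rightarrow> real^'e^'s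
    \<Rightarrow> real^'d^'s \<Rightarrow> ('z \<Rightarrow> real^'d^'e) \<Rightarrow> real^'e^'s \<Rightarrow> real" where
  "bw_loss p \<gamma> Pm \<phi> T \<psi> \<phi>' T' \<psi>' =
    measure_pmf.expectation p (\<lambda>z. bw_term \<gamma> (Pm z) \<phi> (T z) \<psi> \<phi>' (T' z) \<psi>')"

definition td_jepa_loss ::
  "'z pmf \<Rightarrow> real \<Rightarrow> ('z \<Rightarrow> real^'s^'s) \<Rightarrow> real^'d^'s \<Rightarrow> ('z \<Rightarrow> real^'e^'d)
    \<Rightarrow> real^'d^'s \<Rightarrow> ('z \<Rightarrow> real^'e^'d) \<Rightarrow> real^'e^'s \<Rightarrow> real" where
  "td_jepa_loss p \<gamma> Pm \<phi> T \<phi>' T' \<psi>' =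
    measure_pmf.expectation p (\<lambda>z. td_jepa_term \<gamma> (Pm z) \<phi> (T z) \<phi>' (T' z) \<psi>')"

definition fw_optimal ::
  "real \<Rightarrow> real^'s^'s \<Rightarrow> real^'d^'s \<Rightarrow> real^'e^'s \<Rightarrow> real^'e^'d \<Rightarrow> bool" where
  "fw_optimal \<gamma> Pz \<phi> \<psi> T \<longleftrightarrow> GDERIV (\<lambda>X. fw_term \<gamma> Pz \<phi> X \<psi> \<phi> T \<psi>) T :> 0"

definition bw_optimal ::
  "real \<Rightarrow> real^'s^'s \<Rightarrow> real^'d^'s \<Rightarrow> real^'e^'s \<Rightarrow> real^'d^'e \<Rightarrow> bool" where
  "bw_optimal \<gamma> Pz \<phi> \<psi> T \<longleftrightarrow> GDERIV (\<lambda>X. bw_term \<gamma> Pz \<phi> X \<psi> \<phi> T \<psi>) T :> 0"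

definition td_jepa_optimal ::
  "real \<Rightarrow> real^'s^'s \<Rightarrow> real^'d^'s \<Rightarrow> real^'e^'s \<Rightarrow> real^'e^'d \<Rightarrow> bool" where
  "td_jepa_optimal \<gamma> Pz \<phi> \<psi> T \<longleftrightarrow> GDERIV (\<lambda>X. td_jepa_term \<gamma> Pz \<phi> X \<phi> T \<psi>) T :> 0"

end

theory Submission imports Defs begin

text \<open>
  As \<open>Pz\<close> has unit row sums, expanding the square turns the TD-JEPA summand into
  \<open>1/2 \<parallel>\<phi> T - Pz \<psi>' - \<gamma> Pz \<phi>' T'\<parallel>\<^sup>2\<close> up to a constant, so that all losses are least-squares
  functionals. When the columns are orthonormal, the stationarity condition in \<open>T\<close> for both the
  forward and the TD-JEPA summand is \<open>N T = \<phi>\<^sup>T Pz \<psi>\<close> with \<open>N = \<phi>\<^sup>T (I - \<gamma> Pz) \<phi>\<close>, and the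
  gradient in \<open>\<phi>\<close> of both is \<open>(\<phi> T - Pz \<psi> - \<gamma> Pz \<phi> T) T\<^sup>T\<close>. A symmetric stochastic matrix
  satisfies \<open>y \<bullet> Pz y \<le> y \<bullet> y\<close>, so \<open>N\<close> is positive definite; since \<open>Pz = (I - \<gamma> Pz) M\<close>, the
  solution gives \<open>\<phi> T = \<phi> N\<^sup>-\<^sup>1 \<phi>\<^sup>T (I - \<gamma> Pz) M \<psi>\<close>, and \<open>\<phi> N\<^sup>-\<^sup>1 \<phi>\<^sup>T (I - \<gamma> Pz)\<close> is idempotent
  with the range of \<open>\<phi>\<close>. By symmetry of \<open>Pz\<close> the backward summand is the forward one with \<open>\<phi>\<close>
  and \<open>\<psi>\<close> exchanged.
\<close>

section \<open>Matrix multiplication as a bilinear operation\<close>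

lemma matrix_diff_ldistrib: "A ** (B - C) = A ** B - A ** (C :: real^'n^'m)"
  by (simp add: matrix_matrix_mult_def vec_eq_iff right_diff_distrib sum_subtractf)

lemma matrix_diff_rdistrib: "(A - B) ** C = A ** C - B ** (C :: real^'n^'m)"
  by (simp add: matrix_matrix_mult_def vec_eq_iff left_diff_distrib sum_subtractf)

lemma matrix_add_rdistrib: "(A + B) ** C = A ** C + B ** (C :: real^'n^'m)"
  by (simp add: matrix_matrix_mult_def vec_eq_iff distrib_right sum.distrib)

lemma matrix_mult_scaleR_left: "(k *\<^sub>R A) ** B = k *\<^sub>R (A ** (B :: real^'n^'m))"
  by (rule scalar_matrix_assoc[symmetric])

lemma matrix_mult_scaleR_right: "A ** (k *\<^sub>R B) = k *\<^sub>R (A ** (B :: real^'n^'m))"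
  by (simp add: matrix_scalar_ac scalar_matrix_assoc)

lemma bounded_linear_matrix_mult_left:
  fixes A :: "real^'n^'m"
  shows "bounded_linear (\<lambda>X :: real^'k^'n. A ** X)"
  by (intro linear_conv_bounded_linear[THEN iffD1] linearI)
     (simp_all add: matrix_add_ldistrib matrix_mult_scaleR_right)

lemma bounded_linear_matrix_mult_right:
  fixes B :: "real^'k^'n"
  shows "bounded_linear (\<lambda>X :: real^'n^'m. X ** B)"
  by (intro linear_conv_bounded_linear[THEN iffD1] linearI)
     (simp_all add: matrix_add_rdistrib matrix_mult_scaleR_left)

lemma matrix_inv_inverse:
  assumes "invertible A"
  shows "A ** matrix_inv A = mat 1" "matrix_inv A ** A = mat 1"
  using someI_ex[OF assms[unfolded invertible_def]] unfolding matrix_inv_def by auto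

section \<open>Frobenius adjoints and gradients\<close>

lemma inner_matrix_mult_left:
  fixes A :: "real^'n^'m" and B :: "real^'k^'n"
  shows "(A ** B) \<bullet> C = B \<bullet> (transpose A ** C)"
proof -
  have "(A ** B) \<bullet> C = (\<Sum>i\<in>UNIV. \<Sum>k\<in>UNIV. \<Sum>j\<in>UNIV. A$i$j * B$j$k * C$i$k)"
    by (simp add: inner_vec_def matrix_matrix_mult_def sum_distrib_right)
  also have "\<dots> = (\<Sum>i\<in>UNIV. \<Sum>j\<in>UNIV. \<Sum>k\<in>UNIV. A$i$j * B$j$k * C$i$k)"
    by (intro sum.cong refl sum.swap)
  also have "\<dots> = (\<Sum>j\<in>UNIV. \<Sum>i\<in>UNIV. \<Sum>k\<in>UNIV. A$i$j * B$j$k * C$i$k)"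
    by (rule sum.swap)
  also have "\<dots> = (\<Sum>j\<in>UNIV. \<Sum>k\<in>UNIV. \<Sum>i\<in>UNIV. A$i$j * B$j$k * C$i$k)"
    by (intro sum.cong refl sum.swap)
  also have "\<dots> = B \<bullet> (transpose A ** C)"
    by (simp add: inner_vec_def matrix_matrix_mult_def transpose_def sum_distrib_left mult_ac)
  finally show ?thesis .
qed

lemma inner_transpose:
  fixes A B :: "real^'n^'m"
  shows "transpose A \<bullet> transpose B = A \<bullet> B"
  unfolding inner_vec_def transpose_def by (simp, rule sum.swap)

lemma inner_matrix_mult_right:
  fixes A :: "real^'n^'m" and B :: "real^'k^'n"
  shows "(A ** B) \<bullet> C = A \<bullet> (C ** transpose B)"
proof -
  have "(A ** B) \<bullet> C = (transpose B ** transpose A) \<bullet> transpose C"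
    by (metis inner_transpose matrix_transpose_mul)
  also have "\<dots> = transpose A \<bullet> transpose (C ** transpose B)"
    by (simp add: inner_matrix_mult_left matrix_transpose_mul)
  finally show ?thesis by (simp add: inner_transpose)
qed

text \<open>\<open>G\<close> is the adjoint of \<open>L\<close> applied to the residual, described
  through inner products so that no adjoint operator has to be constructed. The constant
  \<open>k\<close> leaves room for the part of the TD-JEPA summand that does not vary.\<close>

lemma GDERIV_least_squares:
  assumes L: "bounded_linear L" and G: "\<And>h. L h \<bullet> (L x - c) = h \<bullet> G"
  shows "GDERIV (\<lambda>X. 1/2 * (norm (L X - c))\<^sup>2 + k) x :> G"
  unfolding gderiv_def power2_norm_eq_inner
  by (rule derivative_eq_intros bounded_linear.has_derivative[OF L] refl)+
     (auto simp: inner_commute G[symmetric])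

lemma GDERIV_unique:
  assumes "GDERIV f x :> G" and "GDERIV f x :> H"
  shows "G = H"
proof -
  have "(\<lambda>h. h \<bullet> G) = (\<lambda>h. h \<bullet> H)"
    using assms unfolding gderiv_def by (rule has_derivative_unique)
  \<comment> \<open>Testing both functionals on the difference makes its squared norm
    vanish.\<close>
  then have "(G - H) \<bullet> G = (G - H) \<bullet> H" by (rule fun_cong)
  then show ?thesis using inner_eq_zero_iff[of "G - H"] by (simp add: inner_diff_right)
qed

text \<open>Turns the optimality predicates into matrix equations once a gradient has been
  computed.\<close>

lemma GDERIV_zero_iff:
  assumes "GDERIV f x :> G"
  shows "GDERIV f x :> 0 \<longleftrightarrow> G = 0"
proof
  assume "GDERIV f x :> 0"
  then show "G = 0" by (rule GDERIV_unique[OF assms])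
next
  assume "G = 0"
  then show "GDERIV f x :> 0" using assms by (simp only:)
qed

text \<open>Over a finite index type the expectation is a finite weighted sum, so differentiating
  under it needs no domination argument.\<close>

lemma GDERIV_expectation:
  fixes p :: "'z::finite pmf"
  assumes "\<And>z. GDERIV (f z) x :> G z"
  shows "GDERIV (\<lambda>X. measure_pmf.expectation p (\<lambda>z. f z X)) x :> (\<Sum>z\<in>UNIV. pmf p z *\<^sub>R G z)"
proof -
  have "measure_pmf.expectation p (\<lambda>z. f z X) = (\<Sum>z\<in>UNIV. f z X * pmf p z)" for X
    by (rule integral_measure_pmf_real) auto
  moreover have "((\<lambda>X. \<Sum>z\<in>UNIV. f z X * pmf p z) has_derivative
      (\<lambda>h. \<Sum>z\<in>UNIV. h \<bullet> G z * pmf p z)) (at x)"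
    using assms unfolding gderiv_def
    by (intro has_derivative_sum has_derivative_mult_left) auto
  ultimately show ?thesis
    by (simp add: gderiv_def inner_sum_right mult.commute)
qed

section \<open>Rows and column spans\<close>

lemma transpose_matrix_vector_row: "transpose T *v row s A = row s (A ** (T :: real^'e^'d))"
  by (simp add: vec_eq_iff row_def transpose_def matrix_vector_mult_def matrix_matrix_mult_def
      mult.commute)

lemma range_matrix_vector_mult_eq_span_columns:
  fixes A :: "real^'d^'s"
  shows "range ((*v) A) = span (columns A)"
proof
  show "range ((*v) A) \<subseteq> span (columns A)"
    by (auto simp: matrix_vector_mult_in_columnspace)
  show "span (columns A) \<subseteq> range ((*v) A)"
  proof (rule span_minimal)
    show "columns A \<subseteq> range ((*v) A)"
      unfolding columns_def by (force simp flip: matrix_vector_mult_basis)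
    show "subspace (range ((*v) A))"
      by (simp add: linear_subspace_image)
  qed
qed

section \<open>Compression to the column span and gradients of the summands\<close>

definition compressed_resolvent :: "real \<Rightarrow> real^'s^'s \<Rightarrow> real^'d^'s \<Rightarrow> real^'d^'d" where
  "compressed_resolvent \<gamma> Pz \<phi> = transpose \<phi> ** (mat 1 - \<gamma> *\<^sub>R Pz) ** \<phi>"

text \<open>Where \<open>compressed_resolvent\<close> is invertible, this is a Galerkin projection:
  the image of a vector lies in the column span of \<open>\<phi>\<close>, and
  \<open>mat 1 - \<gamma> *\<^sub>R Pz\<close> maps the error to a vector orthogonal to that
  span.\<close>

definition resolvent_projection :: "real \<Rightarrow> real^'s^'s \<Rightarrow> real^'d^'s \<Rightarrow> real^'s^'s" where
  "resolvent_projection \<gamma> Pz \<phi> =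
    \<phi> ** matrix_inv (compressed_resolvent \<gamma> Pz \<phi>) ** transpose \<phi> ** (mat 1 - \<gamma> *\<^sub>R Pz)"

text \<open>Only associativity separates the two sides. Symmetry of \<open>Pz\<close> enters later,
  when \<open>transpose Pz\<close> is replaced by \<open>Pz\<close>.\<close>

lemma bw_term_eq_fw_term:
  "bw_term \<gamma> Pz \<phi> T \<psi> \<phi>' T' \<psi>' = fw_term \<gamma> (transpose Pz) \<psi> T \<phi> \<psi>' T' \<phi>'"
  by (simp add: bw_term_def fw_term_def matrix_mul_assoc)

lemma bw_optimal_eq_fw_optimal:
  "bw_optimal \<gamma> Pz \<phi> \<psi> = fw_optimal \<gamma> (transpose Pz) \<psi> \<phi>"
  by (simp add: fun_eq_iff bw_optimal_def fw_optimal_def bw_term_eq_fw_term)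

text \<open>The adjoint multiplies the residual by \<open>transpose \<phi>\<close> on the left and
  \<open>\<psi>\<close> on the right. Orthonormality of \<open>\<psi>\<close> cancels
  \<open>transpose \<psi> ** \<psi>\<close>, and that of \<open>\<phi>\<close> supplies the identity
  part of the compressed resolvent.\<close>

lemma GDERIV_fw_term_predictor:
  assumes "orthonormal_columns \<phi>" "orthonormal_columns \<psi>"
  shows "GDERIV (\<lambda>X. fw_term \<gamma> Pz \<phi> X \<psi> \<phi> T \<psi>) T :>
    (compressed_resolvent \<gamma> Pz \<phi> ** T - transpose \<phi> ** Pz ** \<psi>)"
proof -
  let ?L = "\<lambda>X. \<phi> ** X ** transpose \<psi>"
  let ?c = "Pz + \<gamma> *\<^sub>R (Pz ** \<phi> ** T ** transpose \<psi>)"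
  have L: "bounded_linear ?L"
    by (intro bounded_linear_compose[OF bounded_linear_matrix_mult_right]
        bounded_linear_matrix_mult_left)
  have "transpose \<phi> ** (?L T - ?c) ** \<psi> =
      (transpose \<phi> ** \<phi>) ** T ** (transpose \<psi> ** \<psi>) - transpose \<phi> ** Pz ** \<psi>
      - \<gamma> *\<^sub>R (transpose \<phi> ** Pz ** \<phi> ** T ** (transpose \<psi> ** \<psi>))"
    by (simp add: matrix_diff_ldistrib matrix_diff_rdistrib matrix_add_ldistrib
        matrix_add_rdistrib matrix_mult_scaleR_right matrix_mul_assoc matrix_mult_scaleR_left)
  also have "\<dots> = compressed_resolvent \<gamma> Pz \<phi> ** T - transpose \<phi> ** Pz ** \<psi>"
    using assms unfolding orthonormal_columns_def compressed_resolvent_def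
    by (simp add: matrix_diff_ldistrib matrix_diff_rdistrib matrix_mult_scaleR_right matrix_mult_scaleR_left)
  finally have G: "?L h \<bullet> (?L T - ?c) =
      h \<bullet> (compressed_resolvent \<gamma> Pz \<phi> ** T - transpose \<phi> ** Pz ** \<psi>)" for h
    \<comment> \<open>The instantiation moves only \<open>transpose \<psi>\<close> to the other
      side; the general rule would move \<open>h\<close> as well.\<close>
    unfolding inner_matrix_mult_right[of "\<phi> ** h"]
    by (simp add: inner_matrix_mult_left matrix_mul_assoc)
  show ?thesis
    using GDERIV_least_squares[OF L G, of 0]
    by (simp add: fw_term_def algebra_simps)
qed

text \<open>The adjoint multiplies the residual by \<open>\<psi>\<close> and then by
  \<open>transpose T\<close>. The first factor already reduces the forward residual to the TD-JEPA
  residual, which is why the two gradients agree.\<close>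

lemma GDERIV_fw_term_representation:
  assumes "orthonormal_columns \<psi>"
  shows "GDERIV (\<lambda>X. fw_term \<gamma> Pz X T \<psi> \<phi> T \<psi>) \<phi> :>
    ((\<phi> ** T - Pz ** \<psi> - \<gamma> *\<^sub>R (Pz ** \<phi> ** T)) ** transpose T)"
proof -
  let ?L = "\<lambda>X. X ** T ** transpose \<psi>"
  let ?c = "Pz + \<gamma> *\<^sub>R (Pz ** \<phi> ** T ** transpose \<psi>)"
  have L: "bounded_linear ?L"
    by (intro bounded_linear_compose[OF bounded_linear_matrix_mult_right]
        bounded_linear_matrix_mult_right)
  have "(?L \<phi> - ?c) ** \<psi> = \<phi> ** T ** (transpose \<psi> ** \<psi>) - Pz ** \<psi>
      - \<gamma> *\<^sub>R (Pz ** \<phi> ** T ** (transpose \<psi> ** \<psi>))"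
    by (simp add: matrix_diff_rdistrib matrix_add_rdistrib matrix_mul_assoc matrix_mult_scaleR_left)
  also have "\<dots> = \<phi> ** T - Pz ** \<psi> - \<gamma> *\<^sub>R (Pz ** \<phi> ** T)"
    using assms unfolding orthonormal_columns_def by simp
  finally have G: "?L h \<bullet> (?L \<phi> - ?c) =
      h \<bullet> ((\<phi> ** T - Pz ** \<psi> - \<gamma> *\<^sub>R (Pz ** \<phi> ** T)) ** transpose T)" for h
    by (simp add: inner_matrix_mult_right)
  show ?thesis
    using GDERIV_least_squares[OF L G, of 0]
    by (simp add: fw_term_def algebra_simps)
qed

text \<open>Bias-variance decomposition, row by row: with total weight one, the mean squared
  distance from \<open>Y $ s\<close> to the rows of \<open>C\<close> is the squared distance to
  their mean \<open>(Pz ** C) $ s\<close> plus a variance that does not involve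
  \<open>Y\<close>.\<close>

lemma sum_weighted_square_norms:
  fixes Y C :: "real^'e^'s" and Pz :: "real^'s^'s"
  assumes "\<And>s. (\<Sum>s'\<in>UNIV. Pz $ s $ s') = 1"
  shows "(\<Sum>s\<in>UNIV. \<Sum>s'\<in>UNIV. Pz $ s $ s' * (norm (Y $ s - C $ s'))\<^sup>2) =
    (norm (Y - Pz ** C))\<^sup>2 +
    ((\<Sum>s\<in>UNIV. \<Sum>s'\<in>UNIV. Pz $ s $ s' * (C $ s' \<bullet> C $ s')) - (norm (Pz ** C))\<^sup>2)"
proof -
  have PC: "(Pz ** C) $ s = (\<Sum>s'\<in>UNIV. Pz $ s $ s' *\<^sub>R C $ s')" for s
    by (simp add: vec_eq_iff matrix_matrix_mult_def)
  have "(\<Sum>s'\<in>UNIV. Pz $ s $ s' * (norm (Y $ s - C $ s'))\<^sup>2) =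
      Y $ s \<bullet> Y $ s - 2 * (Y $ s \<bullet> (Pz ** C) $ s) + (\<Sum>s'\<in>UNIV. Pz $ s $ s' * (C $ s' \<bullet> C $ s'))"
    for s
  proof -
    have "(\<Sum>s'\<in>UNIV. Pz $ s $ s' * (norm (Y $ s - C $ s'))\<^sup>2) =
        (\<Sum>s'\<in>UNIV. Pz $ s $ s' * (Y $ s \<bullet> Y $ s) - 2 * (Y $ s \<bullet> (Pz $ s $ s' *\<^sub>R C $ s'))
          + Pz $ s $ s' * (C $ s' \<bullet> C $ s'))"
      by (intro sum.cong refl)
         (simp add: power2_norm_eq_inner inner_diff_left inner_diff_right inner_commute
           algebra_simps)
    also have "\<dots> = (\<Sum>s'\<in>UNIV. Pz $ s $ s') * (Y $ s \<bullet> Y $ s) - 2 * (Y $ s \<bullet> (Pz ** C) $ s)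
        + (\<Sum>s'\<in>UNIV. Pz $ s $ s' * (C $ s' \<bullet> C $ s'))"
      unfolding PC inner_sum_right sum.distrib sum_subtractf sum_distrib_left sum_distrib_right ..
    finally show ?thesis using assms by simp
  qed
  moreover have "(norm (Y - Pz ** C))\<^sup>2 - (norm (Pz ** C))\<^sup>2 =
      (\<Sum>s\<in>UNIV. Y $ s \<bullet> Y $ s - 2 * (Y $ s \<bullet> (Pz ** C) $ s))"
    \<comment> \<open>The type annotation expands the Frobenius inner product into rows and leaves
      the inner products of rows intact.\<close>
    unfolding power2_norm_eq_inner inner_vec_def[of _ "_ :: real^'e^'s"]
      sum_subtractf[symmetric]
    by (intro sum.cong refl) (simp add: inner_diff_left inner_diff_right inner_commute)
  ultimately show ?thesis
    by (simp add: sum.distrib)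
qed

text \<open>The constant is chosen before \<open>\<phi>\<close> and \<open>T\<close>, so it stays
  fixed when differentiating in either of them.\<close>

lemma td_jepa_term_eq_least_squares:
  assumes "\<And>s. (\<Sum>s'\<in>UNIV. Pz $ s $ s') = 1"
  obtains k where "\<And>\<phi> T. td_jepa_term \<gamma> Pz \<phi> T \<phi>' T' \<psi>' =
    1/2 * (norm (\<phi> ** T - (Pz ** \<psi>' + \<gamma> *\<^sub>R (Pz ** \<phi>' ** T'))))\<^sup>2 + k"
proof -
  \<comment> \<open>Row \<open>s'\<close> of \<open>?C\<close> is the bootstrapped target at the
    next state \<open>s'\<close>.\<close>
  let ?C = "\<psi>' + \<gamma> *\<^sub>R (\<phi>' ** T')"
  have PC: "Pz ** ?C = Pz ** \<psi>' + \<gamma> *\<^sub>R (Pz ** \<phi>' ** T')"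
    by (simp add: matrix_add_ldistrib matrix_mult_scaleR_right matrix_mul_assoc)
  have row: "transpose T *v row s \<phi> - row s' \<psi>' - \<gamma> *\<^sub>R (transpose T' *v row s' \<phi>') =
      (\<phi> ** T) $ s - ?C $ s'" for s s' \<phi> T
    unfolding transpose_matrix_vector_row by (simp add: row_def vec_eq_iff)
  show ?thesis
    by (rule that[of "1/2 * ((\<Sum>s\<in>UNIV. \<Sum>s'\<in>UNIV. Pz $ s $ s' * (?C $ s' \<bullet> ?C $ s'))
          - (norm (Pz ** ?C))\<^sup>2)"])
       (simp only: td_jepa_term_def row sum_weighted_square_norms[OF assms] PC distrib_left)
qed

lemma GDERIV_td_jepa_term_predictor:
  assumes "\<And>s. (\<Sum>s'\<in>UNIV. Pz $ s $ s') = 1" and "orthonormal_columns \<phi>"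
  shows "GDERIV (\<lambda>X. td_jepa_term \<gamma> Pz \<phi> X \<phi> T \<psi>) T :>
    (compressed_resolvent \<gamma> Pz \<phi> ** T - transpose \<phi> ** Pz ** \<psi>)"
proof -
  let ?c = "Pz ** \<psi> + \<gamma> *\<^sub>R (Pz ** \<phi> ** T)"
  obtain k where k: "\<And>\<phi>' X. td_jepa_term \<gamma> Pz \<phi>' X \<phi> T \<psi> = 1/2 * (norm (\<phi>' ** X - ?c))\<^sup>2 + k"
    using td_jepa_term_eq_least_squares[OF assms(1)] by blast
  have "transpose \<phi> ** (\<phi> ** T - ?c) =
      compressed_resolvent \<gamma> Pz \<phi> ** T - transpose \<phi> ** Pz ** \<psi>"
    using assms(2) unfolding orthonormal_columns_def compressed_resolvent_def
    by (simp add: matrix_diff_ldistrib matrix_diff_rdistrib matrix_add_ldistrib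
        matrix_mult_scaleR_right matrix_mul_assoc matrix_mult_scaleR_left)
  then show ?thesis
    unfolding k by (intro GDERIV_least_squares bounded_linear_matrix_mult_left)
      (simp add: inner_matrix_mult_left)
qed

lemma GDERIV_td_jepa_term_representation:
  assumes "\<And>s. (\<Sum>s'\<in>UNIV. Pz $ s $ s') = 1"
  shows "GDERIV (\<lambda>X. td_jepa_term \<gamma> Pz X T \<phi> T \<psi>) \<phi> :>
    ((\<phi> ** T - Pz ** \<psi> - \<gamma> *\<^sub>R (Pz ** \<phi> ** T)) ** transpose T)"
proof -
  let ?c = "Pz ** \<psi> + \<gamma> *\<^sub>R (Pz ** \<phi> ** T)"
  obtain k where k: "\<And>\<phi>' X. td_jepa_term \<gamma> Pz \<phi>' X \<phi> T \<psi> = 1/2 * (norm (\<phi>' ** X - ?c))\<^sup>2 + k"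
    using td_jepa_term_eq_least_squares[OF assms] by blast
  show ?thesis
    unfolding k by (intro GDERIV_least_squares bounded_linear_matrix_mult_right)
      (simp add: inner_matrix_mult_right diff_diff_eq)
qed

section \<open>Symmetric stochastic matrices, successor measure and projection\<close>

locale symmetric_stochastic =
  fixes Pz :: "real^'s^'s"
  assumes nonneg: "0 \<le> Pz $ s $ s'"
    and row_sum: "(\<Sum>s'\<in>UNIV. Pz $ s $ s') = 1"
    and symmetric: "transpose Pz = Pz"
begin

text \<open>A product of two coordinates is at most the mean of their squares. Row sums absorb one
  square and column sums, equal to one by symmetry, absorb the other.\<close>

lemma inner_le: "y \<bullet> (Pz *v y) \<le> y \<bullet> y"
proof -
  have col_sum: "(\<Sum>s\<in>UNIV. Pz $ s $ s') = 1" for s'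
  proof -
    have "Pz $ s $ s' = Pz $ s' $ s" for s
      by (subst symmetric[symmetric]) (simp add: transpose_def)
    then show ?thesis using row_sum by simp
  qed
  have "y \<bullet> (Pz *v y) = (\<Sum>s\<in>UNIV. \<Sum>s'\<in>UNIV. Pz $ s $ s' * (y $ s * y $ s'))"
    by (simp add: inner_vec_def matrix_vector_mult_def sum_distrib_left mult_ac)
  also have "\<dots> \<le> (\<Sum>s\<in>UNIV. \<Sum>s'\<in>UNIV. Pz $ s $ s' * (((y $ s)\<^sup>2 + (y $ s')\<^sup>2) / 2))"
  proof (intro sum_mono mult_left_mono nonneg)
    show "y $ s * y $ s' \<le> ((y $ s)\<^sup>2 + (y $ s')\<^sup>2) / 2" for s s'
      using sum_squares_bound[of "y $ s" "y $ s'"] by simp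
  qed
  also have "\<dots> = (\<Sum>s\<in>UNIV. \<Sum>s'\<in>UNIV. Pz $ s $ s' * ((y $ s)\<^sup>2 / 2)) +
      (\<Sum>s\<in>UNIV. \<Sum>s'\<in>UNIV. Pz $ s $ s' * ((y $ s')\<^sup>2 / 2))"
    by (simp add: add_divide_distrib distrib_left sum.distrib)
  also have "(\<Sum>s\<in>UNIV. \<Sum>s'\<in>UNIV. Pz $ s $ s' * ((y $ s')\<^sup>2 / 2)) =
      (\<Sum>s'\<in>UNIV. \<Sum>s\<in>UNIV. Pz $ s $ s' * ((y $ s')\<^sup>2 / 2))"
    by (rule sum.swap)
  finally show ?thesis
    by (simp add: sum_distrib_right[symmetric] row_sum col_sum inner_vec_def
        power2_eq_square sum_divide_distrib[symmetric])
qed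

lemma matrix_power_nonneg: "0 \<le> matrix_power Pz n $ s $ s'"
  by (induction n arbitrary: s)
     (auto simp: mat_def matrix_matrix_mult_def intro!: sum_nonneg mult_nonneg_nonneg nonneg)

lemma matrix_power_row_sum: "(\<Sum>s'\<in>UNIV. matrix_power Pz n $ s $ s') = 1"
proof (induction n arbitrary: s)
  case (Suc n)
  have "(\<Sum>s'\<in>UNIV. matrix_power Pz (Suc n) $ s $ s') =
      (\<Sum>k\<in>UNIV. \<Sum>s'\<in>UNIV. Pz $ s $ k * matrix_power Pz n $ k $ s')"
    by (simp add: matrix_matrix_mult_def) (rule sum.swap)
  then show ?case
    by (simp add: sum_distrib_left[symmetric] Suc row_sum)
qed (simp add: mat_def)

text \<open>Each row is a probability vector and so has norm at most one. Any bound uniform in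
  \<open>n\<close> suffices for comparison with the geometric series.\<close>

lemma norm_matrix_power_le: "norm (matrix_power Pz n) \<le> CARD('s)"
proof -
  have "norm (matrix_power Pz n) \<le> (\<Sum>s\<in>UNIV. norm (matrix_power Pz n $ s))"
    unfolding norm_vec_def[of "matrix_power Pz n"] by (rule L2_set_le_sum) simp
  also have "\<dots> \<le> (\<Sum>s\<in>(UNIV :: 's set). 1)"
  proof (rule sum_mono)
    fix s
    have "norm (matrix_power Pz n $ s) \<le> (\<Sum>s'\<in>UNIV. \<bar>matrix_power Pz n $ s $ s'\<bar>)"
      by (rule norm_le_l1_cart)
    then show "norm (matrix_power Pz n $ s) \<le> 1"
      by (simp add: matrix_power_nonneg matrix_power_row_sum)
  qed
  finally show ?thesis by simp
qed

lemma summable_successor_measure: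
  assumes "0 \<le> \<gamma>" "\<gamma> < 1"
  shows "summable (\<lambda>t. \<gamma> ^ t *\<^sub>R matrix_power Pz (Suc t))"
proof (rule summable_comparison_test')
  show "summable (\<lambda>t. \<gamma> ^ t * CARD('s))"
    using assms by (intro summable_mult2 summable_geometric) auto
  show "norm (\<gamma> ^ t *\<^sub>R matrix_power Pz (Suc t)) \<le> \<gamma> ^ t * CARD('s)" for t
    using assms norm_matrix_power_le[of "Suc t"]
    by (simp del: matrix_power.simps add: mult_left_mono)
qed

text \<open>Multiplication by \<open>\<gamma> *\<^sub>R Pz\<close> shifts the series by one index,
  so the difference telescopes to term zero. This term is \<open>Pz\<close> because the powers start
  at one.\<close>

lemma resolvent_mult_successor_measure:
  assumes "0 \<le> \<gamma>" "\<gamma> < 1"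
  shows "(mat 1 - \<gamma> *\<^sub>R Pz) ** successor_measure \<gamma> Pz = Pz"
proof -
  let ?f = "\<lambda>t. \<gamma> ^ t *\<^sub>R matrix_power Pz (Suc t)"
  have "(\<gamma> *\<^sub>R Pz) ** successor_measure \<gamma> Pz = (\<Sum>t. (\<gamma> *\<^sub>R Pz) ** ?f t)"
    unfolding successor_measure_def
    by (rule bounded_linear.suminf[OF bounded_linear_matrix_mult_left
          summable_successor_measure[OF assms]])
  also have "\<dots> = (\<Sum>t. ?f (Suc t))"
    by (simp add: matrix_mult_scaleR_right matrix_mult_scaleR_left mult.commute)
  also have "\<dots> = successor_measure \<gamma> Pz - ?f 0"
    unfolding successor_measure_def by (rule suminf_split_head[OF summable_successor_measure[OF assms]])
  finally show ?thesis
    by (simp add: matrix_diff_rdistrib)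
qed

text \<open>A square matrix with trivial kernel is invertible. For \<open>x\<close> in the kernel,
  \<open>\<phi> *v x\<close> has the norm of \<open>x\<close>, and the quadratic form at
  \<open>x\<close> is at least \<open>(1 - \<gamma>) * (x \<bullet> x)\<close> by
  \<open>inner_le\<close>.\<close>

lemma invertible_compressed_resolvent:
  fixes \<phi> :: "real^'d^'s"
  assumes "0 \<le> \<gamma>" "\<gamma> < 1" "orthonormal_columns \<phi>"
  shows "invertible (compressed_resolvent \<gamma> Pz \<phi>)" (is "invertible ?N")
proof -
  have "x = 0" if "?N *v x = 0" for x
  proof -
    let ?y = "\<phi> *v x"
    have y: "?y \<bullet> ?y = x \<bullet> x"
      using assms(3) unfolding orthonormal_columns_def
      by (metis dot_lmul_matrix inner_commute matrix_vector_mul_assoc matrix_vector_mul_lid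
          transpose_matrix_vector)
    have "0 = x \<bullet> (?N *v x)"
      using that by simp
    also have "\<dots> = ?y \<bullet> ((mat 1 - \<gamma> *\<^sub>R Pz) *v ?y)"
      by (metis compressed_resolvent_def dot_lmul_matrix inner_commute matrix_vector_mul_assoc
          transpose_matrix_vector)
    also have "\<dots> = ?y \<bullet> ?y - \<gamma> * (?y \<bullet> (Pz *v ?y))"
      by (simp add: matrix_vector_mult_diff_rdistrib inner_diff_right
          flip: scaleR_matrix_vector_assoc)
    also have "\<dots> \<ge> ?y \<bullet> ?y - \<gamma> * (?y \<bullet> ?y)"
      using assms(1) inner_le by (simp add: mult_left_mono)
    finally have "(1 - \<gamma>) * (x \<bullet> x) \<le> 0"
      by (simp add: y algebra_simps)
    then show "x = 0"
      using assms(2) by (metis diff_gt_0_iff_gt inner_gt_zero_iff mult_pos_pos not_less)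
  qed
  then show ?thesis
    by (simp add: invertible_left_inverse matrix_left_invertible_ker)
qed

text \<open>The matrix factors as \<open>\<phi> ** ?B\<close> with \<open>?B\<close> a left inverse
  of \<open>\<phi>\<close>. It therefore fixes \<open>\<phi>\<close>, which gives both idempotence
  and the range.\<close>

lemma oblique_resolvent_projection:
  assumes "0 \<le> \<gamma>" "\<gamma> < 1" "orthonormal_columns \<phi>"
  shows "oblique_projection_onto (resolvent_projection \<gamma> Pz \<phi>) (span (columns \<phi>))"
proof -
  let ?N = "compressed_resolvent \<gamma> Pz \<phi>" and ?A = "resolvent_projection \<gamma> Pz \<phi>"
  let ?B = "matrix_inv ?N ** transpose \<phi> ** (mat 1 - \<gamma> *\<^sub>R Pz)"
  have A: "?A = \<phi> ** ?B"
    by (simp add: resolvent_projection_def matrix_mul_assoc)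
  have "?B ** \<phi> = matrix_inv ?N ** ?N"
    by (simp add: compressed_resolvent_def matrix_mul_assoc)
  also have "\<dots> = mat 1"
    by (rule matrix_inv_inverse(2)[OF invertible_compressed_resolvent[OF assms]])
  finally have range_fixed: "?A ** \<phi> = \<phi>"
    unfolding A by (metis matrix_mul_assoc matrix_mul_rid)
  have "?A ** ?A = ?A"
    by (metis A range_fixed matrix_mul_assoc)
  moreover have "range ((*v) ?A) = range ((*v) \<phi>)"
  proof
    show "range ((*v) ?A) \<subseteq> range ((*v) \<phi>)"
      unfolding A by (auto simp flip: matrix_vector_mul_assoc)
    show "range ((*v) \<phi>) \<subseteq> range ((*v) ?A)"
      by (metis range_fixed image_subsetI matrix_vector_mul_assoc rangeI)
  qed
  ultimately show ?thesis
    by (simp add: oblique_projection_onto_def range_matrix_vector_mult_eq_span_columns)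
qed

section \<open>Stationarity equations and optimal predictors\<close>

lemma td_jepa_optimal_iff:
  assumes "orthonormal_columns \<phi>"
  shows "td_jepa_optimal \<gamma> Pz \<phi> \<psi> T \<longleftrightarrow>
    compressed_resolvent \<gamma> Pz \<phi> ** T = transpose \<phi> ** Pz ** \<psi>"
  unfolding td_jepa_optimal_def
  unfolding GDERIV_zero_iff[OF GDERIV_td_jepa_term_predictor[OF row_sum assms]]
  by (rule right_minus_eq)

lemma fw_optimal_iff:
  assumes "orthonormal_columns \<phi>" "orthonormal_columns \<psi>"
  shows "fw_optimal \<gamma> Pz \<phi> \<psi> T \<longleftrightarrow>
    compressed_resolvent \<gamma> Pz \<phi> ** T = transpose \<phi> ** Pz ** \<psi>"
  unfolding fw_optimal_def
  unfolding GDERIV_zero_iff[OF GDERIV_fw_term_predictor[OF assms]]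
  by (rule right_minus_eq)

lemma bw_optimal_iff:
  assumes "orthonormal_columns \<phi>" "orthonormal_columns \<psi>"
  shows "bw_optimal \<gamma> Pz \<phi> \<psi> T \<longleftrightarrow>
    compressed_resolvent \<gamma> Pz \<psi> ** T = transpose \<psi> ** Pz ** \<phi>"
  using fw_optimal_iff[OF assms(2,1)] by (simp add: bw_optimal_eq_fw_optimal symmetric)

lemma compressed_equation_iff:
  assumes "0 \<le> \<gamma>" "\<gamma> < 1" "orthonormal_columns \<phi>"
  shows "compressed_resolvent \<gamma> Pz \<phi> ** T = B \<longleftrightarrow>
    T = matrix_inv (compressed_resolvent \<gamma> Pz \<phi>) ** B" (is "?N ** T = B \<longleftrightarrow> T = ?I ** B")
proof -
  note inverse = matrix_inv_inverse[OF invertible_compressed_resolvent[OF assms]]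
  have "?I ** (?N ** T) = T" "?N ** (?I ** B) = B"
    by (simp_all only: matrix_mul_assoc inverse matrix_mul_lid)
  then show ?thesis by metis
qed

text \<open>Writing \<open>Pz\<close> as the resolvent factor times the successor measure exposes
  the last factor of \<open>resolvent_projection\<close>.\<close>

lemma compressed_solution_eq_projection:
  assumes "0 \<le> \<gamma>" "\<gamma> < 1" "orthonormal_columns \<phi>"
    and "compressed_resolvent \<gamma> Pz \<phi> ** T = transpose \<phi> ** Pz ** \<psi>"
  shows "\<phi> ** T = resolvent_projection \<gamma> Pz \<phi> ** successor_measure \<gamma> Pz ** \<psi>"
proof -
  have "T = matrix_inv (compressed_resolvent \<gamma> Pz \<phi>) ** (transpose \<phi> ** Pz ** \<psi>)"
    using assms(4) unfolding compressed_equation_iff[OF assms(1-3)] .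
  also have "transpose \<phi> ** Pz ** \<psi> =
      transpose \<phi> ** ((mat 1 - \<gamma> *\<^sub>R Pz) ** successor_measure \<gamma> Pz) ** \<psi>"
    by (simp only: resolvent_mult_successor_measure[OF assms(1,2)])
  finally show ?thesis
    by (simp only: resolvent_projection_def matrix_mul_assoc)
qed

text \<open>The backward predicate takes its representations in exchanged order, so that all three
  predictors are multiplied by \<open>\<phi>\<close>. The claims about \<open>\<psi>\<close> in the
  theorem follow by exchanging \<open>\<phi>\<close> and \<open>\<psi>\<close>.\<close>

lemma optimal_predictors:
  assumes "0 \<le> \<gamma>" "\<gamma> < 1" and orth: "orthonormal_columns \<phi>" "orthonormal_columns \<psi>"
  shows "\<exists>!T. td_jepa_optimal \<gamma> Pz \<phi> \<psi> T" "\<exists>!T. fw_optimal \<gamma> Pz \<phi> \<psi> T"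
    "\<exists>!T. bw_optimal \<gamma> Pz \<psi> \<phi> T"
    "td_jepa_optimal \<gamma> Pz \<phi> \<psi> T \<Longrightarrow>
      \<phi> ** T = resolvent_projection \<gamma> Pz \<phi> ** successor_measure \<gamma> Pz ** \<psi>"
    "fw_optimal \<gamma> Pz \<phi> \<psi> T \<Longrightarrow>
      \<phi> ** T = resolvent_projection \<gamma> Pz \<phi> ** successor_measure \<gamma> Pz ** \<psi>"
    "bw_optimal \<gamma> Pz \<psi> \<phi> T \<Longrightarrow>
      \<phi> ** T = resolvent_projection \<gamma> Pz \<phi> ** successor_measure \<gamma> Pz ** \<psi>"
proof -
  note iffs = td_jepa_optimal_iff[OF orth(1)] fw_optimal_iff[OF orth] bw_optimal_iff[OF orth(2,1)]
  show "\<exists>!T. td_jepa_optimal \<gamma> Pz \<phi> \<psi> T" "\<exists>!T. fw_optimal \<gamma> Pz \<phi> \<psi> T"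
    "\<exists>!T. bw_optimal \<gamma> Pz \<psi> \<phi> T"
    unfolding iffs compressed_equation_iff[OF assms(1-3)] by simp_all
qed (use assms in \<open>simp_all add: td_jepa_optimal_iff fw_optimal_iff bw_optimal_iff
    compressed_solution_eq_projection\<close>)

end

section \<open>Policy matrices and averaging over \<open>z\<close>\<close>

lemma symmetric_stochastic_policy_matrix:
  fixes P :: "'s::finite \<Rightarrow> 'a \<Rightarrow> 's pmf"
  assumes "transpose (policy_matrix P pol z) = policy_matrix P pol z"
  shows "symmetric_stochastic (policy_matrix P pol z)"
  using assms by unfold_locales (simp_all add: policy_matrix_def sum_pmf_eq_1)

theorem theorem3:
  fixes P :: "'s::finite \<Rightarrow> 'a \<Rightarrow> 's pmf"
    and pol :: "'z::finite \<Rightarrow> 's \<Rightarrow> 'a"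
    and p :: "'z pmf"
    and \<gamma> :: real
  assumes "0 \<le> \<gamma>" and "\<gamma> < 1"
    and "\<forall>z. transpose (policy_matrix P pol z) = policy_matrix P pol z"
  shows
    "(\<exists>(Proj\<phi> :: real^'d::finite^'s \<Rightarrow> 'z \<Rightarrow> real^'s^'s) (Proj\<psi> :: real^'e::finite^'s \<Rightarrow> 'z \<Rightarrow> real^'s^'s).
       \<forall>\<phi> \<psi>. orthonormal_columns \<phi> \<longrightarrow> orthonormal_columns \<psi> \<longrightarrow>
        (\<forall>z.
          oblique_projection_onto (Proj\<phi> \<phi> z) (span (columns \<phi>)) \<and>
          oblique_projection_onto (Proj\<psi> \<psi> z) (span (columns \<psi>)) \<and>
          (\<exists>!T. td_jepa_optimal \<gamma> (policy_matrix P pol z) \<phi> \<psi> T) \<and>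
          (\<exists>!T. fw_optimal \<gamma> (policy_matrix P pol z) \<phi> \<psi> T) \<and>
          (\<exists>!T. td_jepa_optimal \<gamma> (policy_matrix P pol z) \<psi> \<phi> T) \<and>
          (\<exists>!T. bw_optimal \<gamma> (policy_matrix P pol z) \<phi> \<psi> T) \<and>
          (\<forall>T\<phi> Tfw. td_jepa_optimal \<gamma> (policy_matrix P pol z) \<phi> \<psi> T\<phi> \<longrightarrow> fw_optimal \<gamma> (policy_matrix P pol z) \<phi> \<psi> Tfw \<longrightarrow>
             \<phi> ** T\<phi> = \<phi> ** Tfw \<and>
             \<phi> ** Tfw = Proj\<phi> \<phi> z ** successor_measure \<gamma> (policy_matrix P pol z) ** \<psi>) \<and>
          (\<forall>T\<psi> Tbw. td_jepa_optimal \<gamma> (policy_matrix P pol z) \<psi> \<phi> T\<psi> \<longrightarrow> bw_optimal \<gamma> (policy_matrix P pol z) \<phi> \<psi> Tbw \<longrightarrow>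
             \<psi> ** T\<psi> = \<psi> ** Tbw \<and>
             \<psi> ** Tbw = Proj\<psi> \<psi> z ** successor_measure \<gamma> (policy_matrix P pol z) ** \<phi>)))
     \<and>
     (\<forall>(\<phi> :: real^'d^'s) (\<psi> :: real^'e^'s).
       orthonormal_columns \<phi> \<longrightarrow> orthonormal_columns \<psi> \<longrightarrow>
        (\<forall>T :: 'z \<Rightarrow> real^'e^'d. \<exists>G.
          (GDERIV (\<lambda>X. td_jepa_loss p \<gamma> (policy_matrix P pol) X T \<phi> T \<psi>) \<phi> :> G) \<and>
          (GDERIV (\<lambda>X. fw_loss p \<gamma> (policy_matrix P pol) X T \<psi> \<phi> T \<psi>) \<phi> :> G)) \<and>
        (\<forall>T :: 'z \<Rightarrow> real^'d^'e. \<exists>G.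
          (GDERIV (\<lambda>X. td_jepa_loss p \<gamma> (policy_matrix P pol) X T \<psi> T \<phi>) \<psi> :> G) \<and>
          (GDERIV (\<lambda>X. bw_loss p \<gamma> (policy_matrix P pol) \<phi> T X \<phi> T \<psi>) \<psi> :> G)))"
proof -
  let ?Pm = "policy_matrix P pol"
  interpret symmetric_stochastic "?Pm z" for z
    by (rule symmetric_stochastic_policy_matrix[OF spec[OF assms(3)]])
  show ?thesis
  proof ((intro conjI allI impI; (elim conjE)?), goal_cases)
    case 1
    show ?case
      \<comment> \<open>One formula provides both witnesses; it mentions only the representation it
        projects onto and the index \<open>z\<close>, besides the fixed data.\<close>
      by (intro exI[of _ "\<lambda>\<phi> z. resolvent_projection \<gamma> (?Pm z) \<phi>"] allI impI conjI)
         (simp_all add: oblique_resolvent_projection optimal_predictors assms(1,2),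
           (metis optimal_predictors(4-6) assms(1,2))+)
  next
    case (2 \<phi> \<psi> T)
    show ?case
      unfolding td_jepa_loss_def fw_loss_def
      \<comment> \<open>The gradient stays schematic until one derivative rule determines it;
        equality with the other gradient is then checked by unification.\<close>
      by (rule exI, rule conjI;
          rule GDERIV_expectation,
          rule GDERIV_td_jepa_term_representation[OF row_sum]
            GDERIV_fw_term_representation[OF 2(2)])
  next
    case (3 \<phi> \<psi> T)
    show ?case
      \<comment> \<open>This reduces the backward loss to a forward one with \<open>\<phi>\<close>
        as the target, so orthonormality of \<open>\<phi>\<close> is now the relevant one.\<close>
      unfolding td_jepa_loss_def bw_loss_def bw_term_eq_fw_term symmetric
      by (rule exI, rule conjI;
          rule GDERIV_expectation,
          rule GDERIV_td_jepa_term_representation[OF row_sum]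
            GDERIV_fw_term_representation[OF 3(1)])
  qed
qed

end
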